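(* Let $x\in\mathbb{C}\setminus(\mathbb{R}^-\cup\{1\})$ and let $\nu\in\mathbb{C}$ with $\mathrm{Re}(\nu)<0$. Let $\mathscr{H}_0$ and the linear operator $\mathfrak{L}:\mathscr{H}_0\to\mathscr{H}_0$ be as defined in the context. Then $\mathfrak{L}$ can be factored on $\mathscr{H}_0$ as $$\mathfrak{L}=\frac{x\,\nu(1-\nu)}{1-x}\cdot\delta\circ\mathfrak{M},$$ where $\delta=z\,\mathrm{d}/\mathrm{d}z$ and $\mathfrak{M}$ is the integral operator on $\mathscr{H}_0$ defined by $$\mathfrak{M}f(z)=\int_0^1e^{-z\,t^{-\nu}(1-(1-x)t)}\,f\left(z\,t^{-\nu}(1-t)\right)\frac{\mathrm{d}t}{t},\qquad z\in\mathbb{C},$$ for all $f\in\mathscr{H}_0$.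
   Context: $\mathbb{R}^-=(-\infty,0]$. $\mathscr{H}_0$ is the complex linear space of entire functions on $\mathbb{C}$ vanishing at $0$. For $x\in\mathbb{C}\setminus(\mathbb{R}^-\cup\{1\})$ and $\mathrm{Re}(\nu)<0$, set $$\mathfrak{R}(\zeta)=x(1-\zeta)^{-\nu}\left(1-(1-x)\zeta\right)^{\nu-1},\quad \zeta\in[0,1],\qquad c=\frac{1-\nu x}{1-x},$$ with principal powers, and define the operator $\mathfrak{L}:\mathscr{H}_0\to\mathscr{H}_0$ by $$\mathfrak{L}f(z)=\int_0^1\left[(1+z\,\mathfrak{R}(\zeta))\,f(\zeta\,\mathfrak{R}(\zeta)\,z)-c\,z\,\mathfrak{R}(\zeta)\,f'(\zeta\,\mathfrak{R}(\zeta)\,z)\right]e^{-\mathfrak{R}(\zeta)z}\,\mathrm{d}\zeta,\qquad z\in\mathbb{C},$$ where $f'$ is the derivative of $f$. The operator $\delta$ acts by $(\delta g)(z)=z\,g'(z)$. For $t\in\,]0,1]$, $t^{-\nu}=e^{-\nu\ln t}$. *)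

theory Defs
  imports "HOL-Complex_Analysis.Complex_Analysis"
begin

definition H0 :: "(complex \<Rightarrow> complex) set" where
  "H0 = {f. f holomorphic_on UNIV \<and> f 0 = 0}"

text \<open>The complex \<open>powr\<close> is the principal power. At \<open>\<zeta> = 1\<close> it gives
  \<open>0 powr (- \<nu>) = 0\<close>, which is the limit value because \<open>Re \<nu> < 0\<close>.\<close>

definition kerR :: "complex \<Rightarrow> complex \<Rightarrow> real \<Rightarrow> complex" where
  "kerR x \<nu> \<zeta> =
     x * (1 - of_real \<zeta>) powr (- \<nu>) * (1 - (1 - x) * of_real \<zeta>) powr (\<nu> - 1)"

definition c_const :: "complex \<Rightarrow> complex \<Rightarrow> complex" where
  "c_const x \<nu> = (1 - \<nu> * x) / (1 - x)"

definition L_integrand ::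
  "complex \<Rightarrow> complex \<Rightarrow> (complex \<Rightarrow> complex) \<Rightarrow> complex \<Rightarrow> real \<Rightarrow> complex" where
  "L_integrand x \<nu> f z \<zeta> =
     ((1 + z * kerR x \<nu> \<zeta>) * f (of_real \<zeta> * kerR x \<nu> \<zeta> * z)
        - c_const x \<nu> * z * kerR x \<nu> \<zeta> * deriv f (of_real \<zeta> * kerR x \<nu> \<zeta> * z))
     * exp (- (kerR x \<nu> \<zeta> * z))"

definition L_op ::
  "complex \<Rightarrow> complex \<Rightarrow> (complex \<Rightarrow> complex) \<Rightarrow> complex \<Rightarrow> complex" where
  "L_op x \<nu> f z = integral {0..1} (L_integrand x \<nu> f z)"

definition tpow :: "complex \<Rightarrow> real \<Rightarrow> complex" where
  "tpow \<nu> t = exp (- \<nu> * of_real (ln t))"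

definition M_integrand ::
  "complex \<Rightarrow> complex \<Rightarrow> (complex \<Rightarrow> complex) \<Rightarrow> complex \<Rightarrow> real \<Rightarrow> complex" where
  "M_integrand x \<nu> f z t =
     exp (- (z * tpow \<nu> t * (1 - (1 - x) * of_real t)))
       * f (z * tpow \<nu> t * (1 - of_real t)) / of_real t"

text \<open>The point \<open>t = 0\<close>, where the integrand is not defined, is left out of the domain
  of integration.\<close>

definition M_op ::
  "complex \<Rightarrow> complex \<Rightarrow> (complex \<Rightarrow> complex) \<Rightarrow> complex \<Rightarrow> complex" where
  "M_op x \<nu> f z = integral {0<..1} (M_integrand x \<nu> f z)"

definition delta_op :: "(complex \<Rightarrow> complex) \<Rightarrow> complex \<Rightarrow> complex" where
  "delta_op g z = z * deriv g z"

end

theory Submission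
  imports Defs
begin

text \<open>
  The substitution \<open>t = (1 - \<zeta>) / (1 - (1 - x) \<zeta>)\<close> satisfies
  \<open>t\<^sup>-\<^sup>\<nu> (1 - (1 - x) t) = R(\<zeta>)\<close> and \<open>t\<^sup>-\<^sup>\<nu> (1 - t) = \<zeta> R(\<zeta>)\<close>, so \<open>L_op\<close> becomes an integral of the
  same exponential and the same argument of \<open>f\<close> as \<open>M_op\<close>. The two integrands still differ, but that of \<open>L_op\<close>
  is a constant multiple of \<open>z\<close> times the \<open>z\<close>-derivative of that of \<open>M_op\<close>, up to the derivative of a
  boundary term, an affine function of \<open>\<zeta>\<close> times \<open>exp (- z R(\<zeta>)) f (z \<zeta> R(\<zeta>))\<close>; this is an algebraic
  identity (\<open>L_primitive_identity\<close>). The boundary term vanishes at both ends, since \<open>f 0 = 0\<close> and \<open>R\<close>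
  tends to \<open>0\<close> at \<open>\<zeta> = 1\<close>.

  For nonreal \<open>x\<close> the substitution leads to an arc from \<open>1\<close> to \<open>0\<close> in the slit plane, and the arc has to
  be moved to the interval from \<open>0\<close> to \<open>1\<close>. With \<open>t = exp u\<close> the integrand is entire in \<open>u\<close> and has an
  entire primitive \<open>G\<close>, so only the end points of the path count. The bound \<open>O(exp (- Re \<nu> * Re u))\<close> on
  horizontal strips (\<open>logM_bounds\<close>) shows that \<open>G\<close> has the same limit along the arc as along the real
  axis (\<open>primitive_vertical_shift\<close>).

  The same bound makes the truncated integrals over \<open>t \<ge> \<epsilon>\<close> converge locally uniformly in \<open>z\<close>. Hence
  \<open>M_op\<close> maps entire functions to entire functions and may be differentiated under the integral sign
  (\<open>M_op_holomorphic_and_deriv_limit\<close>). That \<open>L_op\<close> preserves entire functions vanishing at \<open>0\<close> then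
  follows from the factorization.
\<close>

section \<open>The integrand on the logarithmic scale\<close>

text \<open>The point \<open>t\<close> of the contour is written as \<open>exp u\<close>. The powers \<open>t\<^sup>-\<^sup>\<nu> (1 - (1 - x) t)\<close> and
  \<open>t\<^sup>-\<^sup>\<nu> (1 - t)\<close> become the entire functions \<open>logA\<close> and \<open>logB\<close> of \<open>u\<close>, so that no branch
  has to be followed along complex paths.\<close>
definition logA :: "complex \<Rightarrow> complex \<Rightarrow> complex \<Rightarrow> complex" where
  "logA x \<nu> u = exp (- \<nu> * u) * (1 - (1 - x) * exp u)"

definition logB :: "complex \<Rightarrow> complex \<Rightarrow> complex" where
  "logB \<nu> u = exp (- \<nu> * u) * (1 - exp u)"

text \<open>Since \<open>dt / t = du\<close>, this is the integrand of \<open>M_op\<close> with respect to \<open>u\<close>.\<close>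
definition logM ::
  "complex \<Rightarrow> complex \<Rightarrow> (complex \<Rightarrow> complex) \<Rightarrow> complex \<Rightarrow> complex \<Rightarrow> complex" where
  "logM x \<nu> f z u = exp (- (z * logA x \<nu> u)) * f (z * logB \<nu> u)"

text \<open>The prime means the derivative in \<open>z\<close>, not in the path variable \<open>u\<close>.\<close>
definition logM' ::
  "complex \<Rightarrow> complex \<Rightarrow> (complex \<Rightarrow> complex) \<Rightarrow> complex \<Rightarrow> complex \<Rightarrow> complex" where
  "logM' x \<nu> f z u =
     (logB \<nu> u * deriv f (z * logB \<nu> u) - logA x \<nu> u * f (z * logB \<nu> u))
       * exp (- (z * logA x \<nu> u))"

lemma M_integrand_eq_logM:
  assumes "t > 0"
  shows "M_integrand x \<nu> f z t = logM x \<nu> f z (of_real (ln t)) / of_real t"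
proof -
  have "exp (complex_of_real (ln t)) = of_real t"
    using assms by (metis exp_ln exp_of_real)
  then show ?thesis
    by (simp add: M_integrand_def logM_def logA_def logB_def tpow_def mult.assoc)
qed

lemma H0_has_field_derivative:
  assumes "f \<in> H0"
  shows "(f has_field_derivative deriv f w) (at w)"
  using assms holomorphic_derivI[of f UNIV w] by (auto simp: H0_def)

lemma H0_continuous_on:
  assumes "f \<in> H0" and "continuous_on S g"
  shows "continuous_on S (\<lambda>w. f (g w))" "continuous_on S (\<lambda>w. deriv f (g w))"
proof -
  have "continuous_on UNIV f" "continuous_on UNIV (deriv f)"
    using assms holomorphic_on_imp_continuous_on holomorphic_deriv[of f UNIV]
    by (auto simp: H0_def)
  then show "continuous_on S (\<lambda>w. f (g w))" "continuous_on S (\<lambda>w. deriv f (g w))"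
    using assms(2) continuous_on_compose2 by blast+
qed

text \<open>The linear bound at the origin is what makes the integral over \<open>dt / t\<close> converge.\<close>
lemma H0_linear_bound:
  assumes "f \<in> H0"
  obtains K where "K \<ge> 0" "\<And>w. norm w \<le> r \<Longrightarrow> norm (deriv f w) \<le> K"
    "\<And>w. norm w \<le> r \<Longrightarrow> norm (f w) \<le> K * norm w"
proof -
  have "compact (deriv f ` cball 0 r)"
    using H0_continuous_on(2)[OF assms continuous_on_id] compact_cball
    by (intro compact_continuous_image) auto
  then have "bounded (deriv f ` cball 0 r)"
    by (rule compact_imp_bounded)
  then obtain K where K: "K > 0" "\<And>w. w \<in> cball 0 r \<Longrightarrow> norm (deriv f w) \<le> K"
    unfolding bounded_pos by auto
  have "norm (f w) \<le> K * norm w" if "norm w \<le> r" for w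
  proof -
    have "0 \<le> r"
      using that norm_ge_zero order_trans by blast
    then have "norm (f w - f 0) \<le> K * norm (w - 0)"
      using K(2) H0_has_field_derivative[OF assms] that
      by (intro field_differentiable_bound[of "cball 0 r" f "deriv f" K])
         (auto intro: has_field_derivative_at_within)
    then show ?thesis
      using assms by (simp add: H0_def)
  qed
  then show ?thesis
    using K by (intro that[of K]) auto
qed

text \<open>The factor \<open>exp (- \<nu> u)\<close> has modulus \<open>exp (- Re \<nu> * Re u + Im \<nu> * Im u)\<close>. Its first part decays
  as \<open>Re u\<close> tends to \<open>-\<infinity>\<close> because \<open>Re \<nu> < 0\<close>, and its second part is bounded on a horizontal strip.
  The strips matter because the path that carries \<open>L_op\<close> leaves the real axis.\<close>
lemma logAB_bound:
  fixes x \<nu> u :: complex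
  assumes "Re u \<le> 0" and "\<bar>Im u\<bar> \<le> Y"
  defines "S \<equiv> exp (\<bar>Im \<nu>\<bar> * Y) * (2 + norm (1 - x))"
  shows "norm (logA x \<nu> u) \<le> S * exp (- Re \<nu> * Re u)"
    and "norm (logB \<nu> u) \<le> S * exp (- Re \<nu> * Re u)"
proof -
  have "Im \<nu> * Im u \<le> \<bar>Im \<nu>\<bar> * \<bar>Im u\<bar>"
    by (metis abs_ge_self abs_mult)
  also have "\<dots> \<le> \<bar>Im \<nu>\<bar> * Y"
    using assms by (intro mult_left_mono) auto
  finally have "norm (exp (- \<nu> * u)) \<le> exp (\<bar>Im \<nu>\<bar> * Y + - Re \<nu> * Re u)"
    unfolding norm_exp_eq_Re exp_le_cancel_iff by simp
  then have E: "norm (exp (- \<nu> * u)) \<le> exp (\<bar>Im \<nu>\<bar> * Y) * exp (- Re \<nu> * Re u)"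
    by (simp only: exp_add)
  have e1: "norm (exp u) \<le> 1"
    using assms by (simp add: norm_exp_eq_Re)
  have "norm (1 - (1 - x) * exp u) \<le> 1 + norm (1 - x) * norm (exp u)"
    by (metis norm_mult norm_one norm_triangle_ineq4)
  also have "\<dots> \<le> 2 + norm (1 - x)"
    using mult_left_mono[OF e1, of "norm (1 - x)"] by simp
  finally have P: "norm (1 - (1 - x) * exp u) \<le> 2 + norm (1 - x)" .
  have "norm (1 - exp u) \<le> 1 + norm (exp u)"
    by (metis norm_one norm_triangle_ineq4)
  then have Q: "norm (1 - exp u) \<le> 2 + norm (1 - x)"
    using e1 norm_ge_zero[of "1 - x"] by linarith
  show "norm (logA x \<nu> u) \<le> S * exp (- Re \<nu> * Re u)"
    using mult_mono[OF E P] by (simp add: logA_def S_def norm_mult mult_ac)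
  show "norm (logB \<nu> u) \<le> S * exp (- Re \<nu> * Re u)"
    using mult_mono[OF E Q] by (simp add: logB_def S_def norm_mult mult_ac)
qed

text \<open>Every term has a factor \<open>logA\<close>, \<open>logB\<close> or \<open>f (z * logB)\<close>. By the linear bound on \<open>f\<close> each of these is of
  the order \<open>exp (- Re \<nu> * Re u)\<close>, and all the remaining factors are bounded on the strip, uniformly for
  \<open>z\<close> in a disc.\<close>
lemma logM_bounds:
  assumes "f \<in> H0" and "Re \<nu> < 0" and "r \<ge> 0"
  obtains C where "C \<ge> 0"
    "\<And>z u. \<lbrakk>norm z \<le> r; Re u \<le> 0; \<bar>Im u\<bar> \<le> Y\<rbrakk> \<Longrightarrow>
       norm (logM x \<nu> f z u) \<le> C * exp (- Re \<nu> * Re u)"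
    "\<And>z u. \<lbrakk>norm z \<le> r; Re u \<le> 0; \<bar>Im u\<bar> \<le> Y\<rbrakk> \<Longrightarrow>
       norm (logM' x \<nu> f z u) \<le> C * exp (- Re \<nu> * Re u)"
proof -
  define S where "S = exp (\<bar>Im \<nu>\<bar> * Y) * (2 + norm (1 - x))"
  have S: "S \<ge> 0"
    by (simp add: S_def)
  obtain K where K: "K \<ge> 0" "\<And>w. norm w \<le> r * S \<Longrightarrow> norm (deriv f w) \<le> K"
    "\<And>w. norm w \<le> r * S \<Longrightarrow> norm (f w) \<le> K * norm w"
    using H0_linear_bound[OF assms(1), of "r * S"] by blast
  define C where "C = exp (r * S) * S * K * (r + 1 + r * S)"
  have C1: "exp (r * S) * (K * (r * S)) \<le> C" and C2: "(S * K + S * (K * (r * S))) * exp (r * S) \<le> C"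
    using S K(1) assms(3) by (simp_all add: C_def algebra_simps)
  have "norm (logM x \<nu> f z u) \<le> C * exp (- Re \<nu> * Re u) \<and>
        norm (logM' x \<nu> f z u) \<le> C * exp (- Re \<nu> * Re u)"
    if z: "norm z \<le> r" and u: "Re u \<le> 0" "\<bar>Im u\<bar> \<le> Y" for z u
  proof -
    define e where "e = exp (- Re \<nu> * Re u)"
    have e: "0 \<le> e" "e \<le> 1"
      using assms u mult_nonpos_nonpos[of "Re \<nu>" "Re u"] by (auto simp: e_def)
    have A: "norm (logA x \<nu> u) \<le> S * e" and B: "norm (logB \<nu> u) \<le> S * e"
      using logAB_bound[OF u] unfolding S_def e_def by blast+
    have Se: "S * e \<le> S"
      using S e mult_left_mono[of e 1 S] by simp
    have zA: "norm (z * logA x \<nu> u) \<le> r * S" and zB: "norm (z * logB \<nu> u) \<le> r * (S * e)"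
      using mult_mono[OF z order_trans[OF A Se]] mult_mono[OF z B] assms(3)
      by (simp_all add: norm_mult)
    have zB': "norm (z * logB \<nu> u) \<le> r * S"
      using zB mult_left_mono[OF Se assms(3)] by linarith
    have X: "norm (exp (- (z * logA x \<nu> u))) \<le> exp (r * S)"
      using zA abs_Re_le_cmod[of "z * logA x \<nu> u"]
      unfolding norm_exp_eq_Re exp_le_cancel_iff by simp
    have F: "norm (f (z * logB \<nu> u)) \<le> K * (r * (S * e))"
      using K(3)[OF zB'] mult_left_mono[OF zB K(1)] by linarith
    have F1: "norm (f (z * logB \<nu> u)) \<le> K * (r * S)"
      using K(3)[OF zB'] mult_left_mono[OF zB' K(1)] by linarith
    have "norm (logM x \<nu> f z u) \<le> exp (r * S) * (K * (r * (S * e)))"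
      using mult_mono[OF X F] by (simp add: logM_def norm_mult)
    also have "\<dots> \<le> C * e"
      using mult_right_mono[OF C1 e(1)] by (simp add: mult_ac)
    finally have 1: "norm (logM x \<nu> f z u) \<le> C * e" .
    have "norm (logB \<nu> u * deriv f (z * logB \<nu> u)) \<le> S * e * K"
      using mult_mono[OF B K(2)[OF zB']] S e by (simp add: norm_mult)
    moreover have "norm (logA x \<nu> u * f (z * logB \<nu> u)) \<le> S * e * (K * (r * S))"
      using mult_mono[OF A F1] S e by (simp add: norm_mult)
    ultimately have "norm (logB \<nu> u * deriv f (z * logB \<nu> u) - logA x \<nu> u * f (z * logB \<nu> u))
        \<le> S * e * K + S * e * (K * (r * S))"
      by (rule norm_triangle_le_diff[OF add_mono])
    from mult_mono[OF this X]
    have "norm (logM' x \<nu> f z u) \<le> (S * e * K + S * e * (K * (r * S))) * exp (r * S)"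
      using S e K(1) assms(3) by (simp add: logM'_def norm_mult)
    also have "\<dots> \<le> C * e"
      using mult_right_mono[OF C2 e(1)] by (simp add: algebra_simps)
    finally show ?thesis
      using 1 by (simp add: e_def)
  qed
  moreover have "C \<ge> 0"
    using S K(1) assms(3) by (simp add: C_def)
  ultimately show ?thesis
    by (intro that[of C]) auto
qed

lemma logM_has_field_derivative:
  assumes "f \<in> H0"
  shows "((\<lambda>z. logM x \<nu> f z u) has_field_derivative logM' x \<nu> f z u) (at z within S)"
  unfolding logM_def logM'_def
  by (rule derivative_eq_intros DERIV_chain2[OF H0_has_field_derivative[OF assms]] refl)+
     (simp add: algebra_simps)

lemma continuous_on_logAB [continuous_intros]:
  assumes "continuous_on S g"
  shows "continuous_on S (\<lambda>p. logA x \<nu> (g p))" "continuous_on S (\<lambda>p. logB \<nu> (g p))"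
  unfolding logA_def logB_def by (intro continuous_intros assms)+

lemma continuous_on_logM:
  assumes "f \<in> H0" "continuous_on S g" "continuous_on S h"
  shows "continuous_on S (\<lambda>p. logM x \<nu> f (h p) (g p))"
    and "continuous_on S (\<lambda>p. logM' x \<nu> f (h p) (g p))"
  unfolding logM_def logM'_def
  by (intro continuous_intros H0_continuous_on[OF assms(1)] assms(2,3))+

text \<open>This is where path independence enters: an entire function of \<open>u\<close> has a primitive, and
  its integral along a path is a difference of two values of that primitive.\<close>
lemma logM'_primitive:
  assumes "f \<in> H0"
  obtains G where "\<And>u. (G has_field_derivative logM' x \<nu> f z u) (at u)"
proof -
  have "f holomorphic_on UNIV" "deriv f holomorphic_on UNIV"
    using assms holomorphic_deriv[of f UNIV] by (auto simp: H0_def)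
  then have comp: "(\<lambda>u. f (g u)) holomorphic_on UNIV" "(\<lambda>u. deriv f (g u)) holomorphic_on UNIV"
    if "g holomorphic_on UNIV" for g
    using that holomorphic_on_compose_gen[of g UNIV _ UNIV] by (auto simp: o_def)
  have "logM' x \<nu> f z holomorphic_on UNIV"
    unfolding logM'_def logA_def logB_def
    by (intro holomorphic_intros comp)
  then show ?thesis
    using holomorphic_convex_primitive'[of UNIV "logM' x \<nu> f z"] that by auto
qed

section \<open>The operator \<open>M_op\<close> and its derivative\<close>

lemma M_integrand_bound:
  assumes "f \<in> H0" and "Re \<nu> < 0" and "r \<ge> 0"
  obtains C where "C \<ge> 0"
    "\<And>z t. \<lbrakk>norm z \<le> r; 0 < t; t \<le> 1\<rbrakk> \<Longrightarrow>
       norm (M_integrand x \<nu> f z t) \<le> C * t powr (- Re \<nu> - 1)"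
proof -
  obtain C where C: "C \<ge> 0" "\<And>z u. \<lbrakk>norm z \<le> r; Re u \<le> 0; \<bar>Im u\<bar> \<le> 0\<rbrakk> \<Longrightarrow>
       norm (logM x \<nu> f z u) \<le> C * exp (- Re \<nu> * Re u)"
    using logM_bounds[OF assms, of 0] by metis
  have "norm (M_integrand x \<nu> f z t) \<le> C * t powr (- Re \<nu> - 1)"
    if "norm z \<le> r" and t: "0 < t" "t \<le> 1" for z t
  proof -
    have "norm (M_integrand x \<nu> f z t) = norm (logM x \<nu> f z (of_real (ln t))) / t"
      using t by (simp add: M_integrand_eq_logM norm_divide)
    also have "\<dots> \<le> C * exp (- Re \<nu> * ln t) / t"
      using that C(2)[of z "of_real (ln t)"] by (intro divide_right_mono) auto
    also have "\<dots> = C * (t powr (- Re \<nu>) / t)"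
      using t by (simp add: powr_def)
    also have "\<dots> = C * t powr (- Re \<nu> - 1)"
      using t by (simp add: powr_diff)
    finally show ?thesis .
  qed
  with C(1) show ?thesis using that by blast
qed

lemma M_absolutely_integrable:
  assumes "f \<in> H0" and "Re \<nu> < 0"
  shows "M_integrand x \<nu> f z absolutely_integrable_on {0<..1}"
proof -
  obtain C where C: "\<And>w t. \<lbrakk>norm w \<le> norm z; 0 < t; t \<le> 1\<rbrakk> \<Longrightarrow>
       norm (M_integrand x \<nu> f w t) \<le> C * t powr (- Re \<nu> - 1)"
    using M_integrand_bound[OF assms norm_ge_zero[of z]] by blast
  show ?thesis
  proof (rule measurable_bounded_by_integrable_imp_absolutely_integrable)
    have "continuous_on {0<..1} (\<lambda>t. logM x \<nu> f z (complex_of_real (ln t)) / of_real t)"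
      by (intro continuous_intros continuous_on_logM[OF assms(1)]) auto
    then have "continuous_on {0<..1} (M_integrand x \<nu> f z)"
      by (rule continuous_on_eq) (simp add: M_integrand_eq_logM)
    then show "M_integrand x \<nu> f z \<in> borel_measurable (lebesgue_on {0<..1})"
      by (rule continuous_imp_measurable_on_sets_lebesgue) auto
    have "(\<lambda>t. t powr (- Re \<nu> - 1)) integrable_on {0..1}"
      using assms(2) by (intro integrable_on_powr_from_0) auto
    then have "(\<lambda>t. t powr (- Re \<nu> - 1)) integrable_on {0<..1}"
      by (rule integrable_spike_set) (auto intro: negligible_subset[of "{0}"])
    then show "(\<lambda>t. C * t powr (- Re \<nu> - 1)) integrable_on {0<..1}"
      using integrable_on_cmult_left[of _ "{0<..1}" C] by fastforce
  qed (use C in auto)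
qed

text \<open>The bound does not depend on \<open>z\<close> in a disc, so that the truncated integrals converge to
  \<open>M_op\<close> locally uniformly.\<close>
lemma M_integral_tail_bound:
  assumes f: "f \<in> H0" and \<nu>: "Re \<nu> < 0" and "r \<ge> 0"
  obtains C where "C \<ge> 0"
    "\<And>z \<epsilon>. \<lbrakk>norm z \<le> r; 0 < \<epsilon>; \<epsilon> \<le> 1\<rbrakk> \<Longrightarrow>
       norm (integral {\<epsilon>..1} (M_integrand x \<nu> f z) - M_op x \<nu> f z) \<le> C * \<epsilon> powr (- Re \<nu>)"
proof -
  obtain C where C: "C \<ge> 0" "\<And>z t. \<lbrakk>norm z \<le> r; 0 < t; t \<le> 1\<rbrakk> \<Longrightarrow>
       norm (M_integrand x \<nu> f z t) \<le> C * t powr (- Re \<nu> - 1)"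
    using M_integrand_bound[OF assms] by blast
  have "norm (integral {\<epsilon>..1} (M_integrand x \<nu> f z) - M_op x \<nu> f z)
      \<le> C / (- Re \<nu>) * \<epsilon> powr (- Re \<nu>)" if z: "norm z \<le> r" and \<epsilon>: "0 < \<epsilon>" "\<epsilon> \<le> 1" for z \<epsilon>
  proof -
    have I: "M_integrand x \<nu> f z integrable_on {0<..1}"
      using M_absolutely_integrable[OF f \<nu>] absolutely_integrable_on_def by blast
    have I': "M_integrand x \<nu> f z integrable_on {0..1}"
      by (rule integrable_spike_set[OF I]) (auto intro: negligible_subset[of "{0}"])
    have eq: "M_op x \<nu> f z = integral {0..1} (M_integrand x \<nu> f z)"
      unfolding M_op_def
      by (rule integral_spike_set) (auto intro: negligible_subset[of "{0}"])
    have "integral {0..\<epsilon>} (M_integrand x \<nu> f z) + integral {\<epsilon>..1} (M_integrand x \<nu> f z) = M_op x \<nu> f z"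
      unfolding eq using \<epsilon> by (intro Henstock_Kurzweil_Integration.integral_combine I') auto
    then have "norm (integral {\<epsilon>..1} (M_integrand x \<nu> f z) - M_op x \<nu> f z)
        = norm (integral {0..\<epsilon>} (M_integrand x \<nu> f z))"
      by (metis add_diff_cancel_right' norm_minus_commute)
    also have "integral {0..\<epsilon>} (M_integrand x \<nu> f z) = integral {0<..\<epsilon>} (M_integrand x \<nu> f z)"
      by (rule integral_spike_set) (auto intro: negligible_subset[of "{0}"])
    also have "norm \<dots> \<le> integral {0<..\<epsilon>} (\<lambda>t. C * t powr (- Re \<nu> - 1))"
    proof (rule Henstock_Kurzweil_Integration.integral_norm_bound_integral)
      have "M_integrand x \<nu> f z integrable_on {0..\<epsilon>}"
        by (rule integrable_subinterval_real[OF I']) (use \<epsilon> in auto)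
      then show "M_integrand x \<nu> f z integrable_on {0<..\<epsilon>}"
        by (rule integrable_spike_set) (auto intro: negligible_subset[of "{0}"])
      have "(\<lambda>t. t powr (- Re \<nu> - 1)) integrable_on {0..\<epsilon>}"
        using \<nu> \<epsilon> by (intro integrable_on_powr_from_0) auto
      then have "(\<lambda>t. t powr (- Re \<nu> - 1)) integrable_on {0<..\<epsilon>}"
        by (rule integrable_spike_set) (auto intro: negligible_subset[of "{0}"])
      then show "(\<lambda>t. C * t powr (- Re \<nu> - 1)) integrable_on {0<..\<epsilon>}"
        using integrable_on_cmult_left[of _ "{0<..\<epsilon>}" C] by fastforce
    qed (use z \<epsilon> C in auto)
    also have "\<dots> = integral {0..\<epsilon>} (\<lambda>t. C * t powr (- Re \<nu> - 1))"
      by (rule integral_spike_set) (auto intro: negligible_subset[of "{0}"])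
    also have "\<dots> = C * (\<epsilon> powr (- Re \<nu>) / (- Re \<nu>))"
      using has_integral_powr_from_0[of "- Re \<nu> - 1" \<epsilon>] \<nu> \<epsilon> 
      by (simp add: integral_unique has_integral_mult_right)
    finally show ?thesis by simp
  qed
  moreover have "C / (- Re \<nu>) \<ge> 0"
    using C(1) \<nu> by (intro divide_nonneg_pos) auto
  ultimately show ?thesis using that by blast
qed

text \<open>Away from \<open>t = 0\<close> the integral can be differentiated under the integral sign, and
  the result is evaluated by the primitive along the real interval from \<open>ln \<epsilon>\<close> to \<open>0\<close>.\<close>
lemma truncated_M_has_field_derivative:
  assumes f: "f \<in> H0" and \<epsilon>: "0 < \<epsilon>" "\<epsilon> \<le> 1"
    and G: "\<And>u. (G has_field_derivative logM' x \<nu> f z u) (at u)"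
  shows "((\<lambda>z. integral {\<epsilon>..1} (M_integrand x \<nu> f z)) has_field_derivative
           G 0 - G (of_real (ln \<epsilon>))) (at z)"
proof -
  have "((\<lambda>z. integral (cbox \<epsilon> 1) (M_integrand x \<nu> f z)) has_field_derivative
      integral (cbox \<epsilon> 1) (\<lambda>t. logM' x \<nu> f z (of_real (ln t)) / of_real t)) (at z within UNIV)"
  proof (rule leibniz_rule_field_derivative)
    fix z t assume "t \<in> cbox \<epsilon> 1"
    then have t: "t > 0" using \<epsilon> by auto
    show "((\<lambda>z. M_integrand x \<nu> f z t) has_field_derivative
        logM' x \<nu> f z (of_real (ln t)) / of_real t) (at z within UNIV)"
      unfolding M_integrand_eq_logM[OF t]
      by (intro DERIV_cdivide logM_has_field_derivative f)
  next
    fix z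
    have "M_integrand x \<nu> f z integrable_on {\<epsilon>..1}"
    proof (rule integrable_continuous_real)
      have "continuous_on {\<epsilon>..1} (\<lambda>t. logM x \<nu> f z (complex_of_real (ln t)) / of_real t)"
        using \<epsilon> by (intro continuous_intros continuous_on_logM[OF f]) auto
      then show "continuous_on {\<epsilon>..1} (M_integrand x \<nu> f z)"
        by (rule continuous_on_eq) (use \<epsilon> in \<open>auto simp: M_integrand_eq_logM\<close>)
    qed
    then show "M_integrand x \<nu> f z integrable_on cbox \<epsilon> 1" by simp
  next
    show "continuous_on (UNIV \<times> cbox \<epsilon> 1)
        (\<lambda>(z, t). logM' x \<nu> f z (complex_of_real (ln t)) / of_real t)"
      unfolding case_prod_beta
      using \<epsilon> by (intro continuous_intros continuous_on_logM[OF f]) auto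
  qed auto
  moreover have "((\<lambda>t. logM' x \<nu> f z (of_real (ln t)) / of_real t) has_integral
      G (of_real (ln 1)) - G (of_real (ln \<epsilon>))) {\<epsilon>..1}"
  proof (rule fundamental_theorem_of_calculus)
    fix t assume "t \<in> {\<epsilon>..1}"
    then have "t > 0" using \<epsilon> by auto
    then have "((\<lambda>t. of_real (ln t)) has_vector_derivative complex_of_real (1 / t)) (at t within {\<epsilon>..1})"
      unfolding inverse_eq_divide[symmetric]
      by (intro has_vector_derivative_of_real has_field_derivative_at_within[OF DERIV_ln])
    from field_vector_diff_chain_within[OF this has_field_derivative_at_within[OF G]]
    show "((\<lambda>t. G (of_real (ln t))) has_vector_derivative
        logM' x \<nu> f z (of_real (ln t)) / of_real t) (at t within {\<epsilon>..1})"
      by (simp add: o_def field_simps)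
  qed (use \<epsilon> in auto)
  ultimately show ?thesis
    by (simp add: integral_unique)
qed

text \<open>By Weierstrass' theorem a locally uniform limit of entire functions is entire, and the
  derivatives converge to the derivative of the limit.\<close>
lemma M_op_holomorphic_and_deriv_limit:
  assumes f: "f \<in> H0" and \<nu>: "Re \<nu> < 0"
    and \<epsilon>: "\<And>n. 0 < \<epsilon> n" "\<And>n. \<epsilon> n \<le> 1" "\<epsilon> \<longlonglongrightarrow> 0"
  shows "M_op x \<nu> f holomorphic_on UNIV"
    and "\<lbrakk>\<And>u. (G has_field_derivative logM' x \<nu> f z u) (at u)\<rbrakk> \<Longrightarrow>
         (\<lambda>n. G 0 - G (of_real (ln (\<epsilon> n)))) \<longlonglongrightarrow> deriv (M_op x \<nu> f) z"
proof -
  define M where "M n z = integral {\<epsilon> n..1} (M_integrand x \<nu> f z)" for n z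
  have "\<exists>P. \<forall>u. (P has_field_derivative logM' x \<nu> f w u) (at u)" for w
    using logM'_primitive[OF f] by metis
  then obtain P where P: "\<And>w u. (P w has_field_derivative logM' x \<nu> f w u) (at u)"
    by metis
  have M': "(M n has_field_derivative P w 0 - P w (of_real (ln (\<epsilon> n)))) (at w)" for n w
    unfolding M_def by (intro truncated_M_has_field_derivative f \<epsilon> P)
  have "uniform_limit (cball w 1) M (M_op x \<nu> f) sequentially" for w
  proof -
    obtain C where C: "C \<ge> 0" "\<And>z \<epsilon>. \<lbrakk>norm z \<le> norm w + 1; 0 < \<epsilon>; \<epsilon> \<le> 1\<rbrakk> \<Longrightarrow>
       norm (integral {\<epsilon>..1} (M_integrand x \<nu> f z) - M_op x \<nu> f z) \<le> C * \<epsilon> powr (- Re \<nu>)"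
      using M_integral_tail_bound[OF f \<nu>, of "norm w + 1"] by auto
    have "(\<lambda>n. C * \<epsilon> n powr (- Re \<nu>)) \<longlonglongrightarrow> C * 0"
      using \<nu> less_imp_le[OF \<epsilon>(1)]
      by (intro tendsto_mult tendsto_const tendsto_zero_powrI[OF \<epsilon>(3) tendsto_const]) simp_all
    then have lim: "(\<lambda>n. C * \<epsilon> n powr (- Re \<nu>)) \<longlonglongrightarrow> 0" by simp
    show ?thesis
    proof (rule uniform_limitI)
      fix e :: real assume "e > 0"
      with lim have "\<forall>\<^sub>F n in sequentially. C * \<epsilon> n powr (- Re \<nu>) < e"
        by (rule order_tendstoD)
      then show "\<forall>\<^sub>F n in sequentially. \<forall>z\<in>cball w 1. dist (M n z) (M_op x \<nu> f z) < e"
      proof eventually_elim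
        case (elim n)
        show ?case
        proof
          fix z assume "z \<in> cball w 1"
          then have "norm z \<le> norm w + 1"
            using norm_triangle_ineq2[of z w] by (simp add: dist_norm norm_minus_commute)
          from C(2)[OF this \<epsilon>(1,2)[of n]] elim show "dist (M n z) (M_op x \<nu> f z) < e"
            unfolding dist_norm M_def by (rule le_less_trans)
        qed
      qed
    qed
  qed
  then have "\<exists>d>0. cball w d \<subseteq> UNIV \<and> uniform_limit (cball w d) M (M_op x \<nu> f) sequentially" for w
    by (intro exI[of _ 1]) simp
  then have "\<exists>g'. \<forall>w\<in>UNIV. (M_op x \<nu> f has_field_derivative g' w) (at w) \<and>
      (\<lambda>n. P w 0 - P w (of_real (ln (\<epsilon> n)))) \<longlonglongrightarrow> g' w"
    by (intro has_complex_derivative_uniform_sequence[of UNIV M]) (use M' in auto)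
  then obtain g' where
    g'_both: "\<forall>w\<in>UNIV. (M_op x \<nu> f has_field_derivative g' w) (at w) \<and>
      (\<lambda>n. P w 0 - P w (of_real (ln (\<epsilon> n)))) \<longlonglongrightarrow> g' w" ..
  then have g': "\<And>w. (M_op x \<nu> f has_field_derivative g' w) (at w)"
    "\<And>w. (\<lambda>n. P w 0 - P w (of_real (ln (\<epsilon> n)))) \<longlonglongrightarrow> g' w"
    by simp_all
  show "M_op x \<nu> f holomorphic_on UNIV"
    using g'(1) by (auto simp: holomorphic_on_def field_differentiable_def)
  show "(\<lambda>n. G 0 - G (of_real (ln (\<epsilon> n)))) \<longlonglongrightarrow> deriv (M_op x \<nu> f) z"
    if G: "\<And>u. (G has_field_derivative logM' x \<nu> f z u) (at u)"
  proof -
    have "G 0 - G (of_real (ln (\<epsilon> n))) = P z 0 - P z (of_real (ln (\<epsilon> n)))" for n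
      using DERIV_unique[OF M'[of n z, unfolded M_def]
          truncated_M_has_field_derivative[OF f \<epsilon>(1,2) G]] by simp
    then show ?thesis
      using g'(2)[of z] DERIV_imp_deriv[OF g'(1)[of z]] by simp
  qed
qed

section \<open>Moving the path to the real axis\<close>

text \<open>The primitive has the same behaviour at the end \<open>Re u = -\<infinity>\<close> of the strip along every path: on
  the vertical segment from \<open>U n\<close> to the real axis, of bounded length, its derivative tends to \<open>0\<close>
  uniformly.\<close>
lemma primitive_vertical_shift:
  assumes f: "f \<in> H0" and \<nu>: "Re \<nu> < 0"
    and G: "\<And>u. (G has_field_derivative logM' x \<nu> f z u) (at u)"
    and U: "filterlim (\<lambda>n. Re (U n)) at_bot sequentially" "\<And>n. \<bar>Im (U n)\<bar> \<le> Y"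
  shows "(\<lambda>n. G (U n) - G (of_real (Re (U n)))) \<longlonglongrightarrow> 0"
proof -
  obtain C where C: "C \<ge> 0" "\<And>u. \<lbrakk>Re u \<le> 0; \<bar>Im u\<bar> \<le> Y\<rbrakk> \<Longrightarrow>
       norm (logM' x \<nu> f z u) \<le> C * exp (- Re \<nu> * Re u)"
    using logM_bounds[OF f \<nu> norm_ge_zero[of z], of Y] by (metis order_refl)
  have Y: "Y \<ge> 0" using U(2)[of 0] by linarith
  have bound: "norm (G u - G (of_real (Re u))) \<le> C * exp (- Re \<nu> * Re u) * Y"
    if u: "Re u \<le> 0" "\<bar>Im u\<bar> \<le> Y" for u
  proof -
    define T where "T = {w. Re w = Re u \<and> \<bar>Im w\<bar> \<le> Y}"
    have "T = ({w. Re w \<le> Re u} \<inter> {w. Re w \<ge> Re u}) \<inter> ({w. Im w \<le> Y} \<inter> {w. Im w \<ge> - Y})"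
      by (auto simp: T_def)
    then have "convex T"
      by (simp only: convex_Int convex_halfspace_Im_le convex_halfspace_Im_ge
          convex_halfspace_Re_le convex_halfspace_Re_ge)
    then have "norm (G u - G (of_real (Re u))) \<le> C * exp (- Re \<nu> * Re u) * norm (u - of_real (Re u))"
    proof (rule field_differentiable_bound)
      show "norm (logM' x \<nu> f z w) \<le> C * exp (- Re \<nu> * Re u)" if "w \<in> T" for w
        using that u C(2)[of w] by (auto simp: T_def)
    qed (use u Y in \<open>auto simp: T_def intro: has_field_derivative_at_within[OF G]\<close>)
    also have "norm (u - of_real (Re u)) = \<bar>Im u\<bar>"
      by (simp add: cmod_eq_Im)
    finally show ?thesis
      using mult_left_mono[OF u(2), of "C * exp (- Re \<nu> * Re u)"] C(1) by simp
  qed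
  have "filterlim (\<lambda>n. - Re \<nu> * Re (U n)) at_bot sequentially"
    using \<nu> by (intro filterlim_tendsto_pos_mult_at_bot[OF tendsto_const _ U(1)]) auto
  then have "(\<lambda>n. exp (- Re \<nu> * Re (U n))) \<longlonglongrightarrow> 0"
    by (rule filterlim_compose[OF exp_at_bot])
  then have "(\<lambda>n. C * exp (- Re \<nu> * Re (U n)) * Y) \<longlonglongrightarrow> C * 0 * Y"
    by (intro tendsto_intros)
  then have "(\<lambda>n. C * exp (- Re \<nu> * Re (U n)) * Y) \<longlonglongrightarrow> 0" by simp
  moreover have "\<forall>\<^sub>F n in sequentially. Re (U n) \<le> 0"
    using U(1) by (auto simp: filterlim_at_bot)
  then have "\<forall>\<^sub>F n in sequentially. norm (G (U n) - G (of_real (Re (U n)))) \<le> C * exp (- Re \<nu> * Re (U n)) * Y"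
    by eventually_elim (rule bound[OF _ U(2)])
  ultimately show ?thesis
    by (rule Lim_null_comparison[rotated])
qed

section \<open>The substitution in \<open>L_op\<close>\<close>

text \<open>The logarithm of \<open>t = (1 - \<zeta>) / (1 - (1 - x) \<zeta>)\<close>. As a difference of two principal
  logarithms it splits \<open>t\<^sup>-\<^sup>\<nu>\<close> into the principal powers of \<open>1 - \<zeta>\<close> and \<open>1 - (1 - x) \<zeta>\<close>, as in \<open>kerR\<close>.\<close>
definition logpath :: "complex \<Rightarrow> complex \<Rightarrow> complex" where
  "logpath x v = Ln (1 - v) - Ln (1 - (1 - x) * v)"

text \<open>The plane slit along the nonpositive reals is star-shaped about \<open>1\<close>, and the point is a convex
  combination of \<open>1\<close> and \<open>x\<close>.\<close>
lemma segment_to_x_avoids_slit: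
  fixes x :: complex
  assumes "x \<notin> \<real>\<^sub>\<le>\<^sub>0" and "0 \<le> s" "s \<le> 1"
  shows "1 - (1 - x) * of_real s \<notin> \<real>\<^sub>\<le>\<^sub>0"
proof
  assume "1 - (1 - x) * of_real s \<in> \<real>\<^sub>\<le>\<^sub>0"
  then have Im: "Im x * s = 0" and Re: "1 - s + s * Re x \<le> 0"
    by (auto simp: complex_nonpos_Reals_iff algebra_simps)
  from Re have "s \<noteq> 0" by auto
  then have "Im x = 0" "s > 0" using Im assms by auto
  then have "Re x > 0"
    using assms by (auto simp: complex_nonpos_Reals_iff)
  then have "s * Re x > 0" using \<open>s > 0\<close> by simp
  then show False using Re assms by linarith
qed

lemma exp_logpath:
  assumes "v \<noteq> 1" "1 - (1 - x) * v \<noteq> 0"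
  shows "exp (logpath x v) = (1 - v) / (1 - (1 - x) * v)"
  using assms by (simp add: logpath_def exp_diff)

lemma logAB_logpath:
  fixes v x \<nu> :: complex
  assumes "v \<noteq> 1" and D: "1 - (1 - x) * v \<noteq> 0"
  defines "p \<equiv> exp (- \<nu> * logpath x v)"
  shows "logA x \<nu> (logpath x v) = p * (x / (1 - (1 - x) * v))"
    and "logB \<nu> (logpath x v) = p * (x * v / (1 - (1 - x) * v))"
proof -
  have "1 - (1 - x) * ((1 - v) / (1 - (1 - x) * v)) = x / (1 - (1 - x) * v)"
    "1 - (1 - v) / (1 - (1 - x) * v) = x * v / (1 - (1 - x) * v)"
    using D by (simp_all add: divide_simps) (simp_all add: algebra_simps)
  then show "logA x \<nu> (logpath x v) = p * (x / (1 - (1 - x) * v))"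
    and "logB \<nu> (logpath x v) = p * (x * v / (1 - (1 - x) * v))"
    unfolding logA_def logB_def p_def exp_logpath[OF assms(1,2)] by simp_all
qed

text \<open>The substitution turns both arguments that occur in the integrand of \<open>L_op\<close> into those of
  \<open>M_op\<close>.\<close>
lemma kerR_eq_logA:
  assumes "x \<notin> \<real>\<^sub>\<le>\<^sub>0" and "0 \<le> s" "s < 1"
  shows "kerR x \<nu> s = logA x \<nu> (logpath x (of_real s))"
    and "of_real s * kerR x \<nu> s = logB \<nu> (logpath x (of_real s))"
proof -
  let ?D = "1 - (1 - x) * complex_of_real s"
  have D: "?D \<noteq> 0"
    using segment_to_x_avoids_slit[of x s] assms by auto
  have s: "complex_of_real s \<noteq> 1" using assms by auto
  have "(1 - complex_of_real s) powr (- \<nu>) * ?D powr (\<nu> - 1)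
      = exp (- \<nu> * Ln (1 - of_real s)) * (exp (\<nu> * Ln ?D) / exp (Ln ?D))"
    using s D by (simp add: powr_def left_diff_distrib exp_diff)
  also have "\<dots> = exp (- \<nu> * logpath x (of_real s)) / ?D"
    using D by (simp add: logpath_def right_diff_distrib exp_diff exp_minus field_simps)
  finally have R: "kerR x \<nu> s = exp (- \<nu> * logpath x (of_real s)) * (x / ?D)"
    by (simp add: kerR_def mult.assoc)
  then show "kerR x \<nu> s = logA x \<nu> (logpath x (of_real s))"
    and "of_real s * kerR x \<nu> s = logB \<nu> (logpath x (of_real s))"
    using logAB_logpath[OF s D] by simp_all
qed

lemma logpath_has_field_derivative:
  assumes "1 - v \<notin> \<real>\<^sub>\<le>\<^sub>0" "1 - (1 - x) * v \<notin> \<real>\<^sub>\<le>\<^sub>0"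
  shows "(logpath x has_field_derivative - x / ((1 - v) * (1 - (1 - x) * v))) (at v)"
proof -
  have "1 - v \<noteq> 0" "1 - (1 - x) * v \<noteq> 0"
    using assms by auto
  then have "inverse (1 - v) * - 1 - inverse (1 - (1 - x) * v) * - (1 - x)
      = - x / ((1 - v) * (1 - (1 - x) * v))"
    by (simp add: divide_simps) (simp add: algebra_simps)
  moreover have "((\<lambda>v. 1 - v) has_field_derivative - 1) (at v)"
    "((\<lambda>v. 1 - (1 - x) * v) has_field_derivative - (1 - x)) (at v)"
    by (auto intro!: derivative_eq_intros)
  then have "(logpath x has_field_derivative
      inverse (1 - v) * - 1 - inverse (1 - (1 - x) * v) * - (1 - x)) (at v)"
    unfolding logpath_def[abs_def]
    by (intro DERIV_diff DERIV_chain2[OF has_field_derivative_Ln] assms)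
  ultimately show ?thesis by simp
qed

section \<open>An antiderivative of the integrand of \<open>L_op\<close>\<close>

lemma logM_has_field_derivative_log:
  assumes "f \<in> H0"
  shows "(logM x \<nu> f z has_field_derivative
      z * exp (- \<nu> * u) * ((\<nu> * (1 - (1 - x) * exp u) + (1 - x) * exp u) * f (z * logB \<nu> u)
        - (\<nu> * (1 - exp u) + exp u) * deriv f (z * logB \<nu> u)) * exp (- (z * logA x \<nu> u))) (at u)"
proof -
  have A: "(logA x \<nu> has_field_derivative
      - exp (- \<nu> * u) * (\<nu> * (1 - (1 - x) * exp u) + (1 - x) * exp u)) (at u)"
    unfolding logA_def
    by (rule derivative_eq_intros refl)+ (simp add: algebra_simps)
  have B: "(logB \<nu> has_field_derivative - exp (- \<nu> * u) * (\<nu> * (1 - exp u) + exp u)) (at u)"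
    unfolding logB_def
    by (rule derivative_eq_intros refl)+ (simp add: algebra_simps)
  show ?thesis
    unfolding logM_def
    by (rule derivative_eq_intros DERIV_chain2[OF H0_has_field_derivative[OF assms]] A B refl)+
       (simp add: algebra_simps)
qed

text \<open>An antiderivative of the integrand of \<open>L_op\<close>, where \<open>G\<close> is a primitive of \<open>logM'\<close>. The second term
  carries \<open>\<delta> \<circ> M_op\<close>. The first is a boundary term that vanishes at both ends. Its coefficient comes
  from the ansatz that the two integrands differ by the derivative of \<open>h * logM\<close>: comparing the
  coefficients of \<open>f\<close> gives \<open>h' = 1\<close>, hence \<open>h\<close> up to a constant, and comparing those of \<open>z f\<close>
  determines this constant and the factor \<open>x \<nu> (1 - \<nu>) / (1 - x)\<close>.\<close>
definition L_primitive ::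
  "complex \<Rightarrow> complex \<Rightarrow> (complex \<Rightarrow> complex) \<Rightarrow> complex \<Rightarrow> (complex \<Rightarrow> complex)
     \<Rightarrow> complex \<Rightarrow> complex" where
  "L_primitive x \<nu> f z G v =
     - ((1 - (1 - x) * v - \<nu> * x) / (1 - x) * logM x \<nu> f z (logpath x v)
        + x * \<nu> * (1 - \<nu>) / (1 - x) * z * G (logpath x v))"

text \<open>The algebra behind the antiderivative. Here \<open>p\<close> stands for \<open>exp (- \<nu> u)\<close>, and \<open>F\<close> and \<open>F'\<close> stand
  for the values of \<open>f\<close> and its derivative, both times the exponential factor; the identity holds
  separately for the coefficients of \<open>F\<close> and of \<open>F'\<close>. The second one is where the value of the
  constant \<open>c\<close> is needed.\<close>
lemma L_primitive_identity:
  fixes x \<nu> v z p F F' :: complex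
  assumes "x \<noteq> 1" "v \<noteq> 1" and D: "D \<noteq> 0" "D = 1 - (1 - x) * v"
  defines "A \<equiv> p * (x / D)" and "B \<equiv> p * (x * v / D)" and "w \<equiv> (1 - v) / D"
  shows "- (- F + (D - \<nu> * x) / (1 - x) *
             (z * p * ((\<nu> * (1 - (1 - x) * w) + (1 - x) * w) * F - (\<nu> * (1 - w) + w) * F')
               * (- x / ((1 - v) * D)))
           + x * \<nu> * (1 - \<nu>) / (1 - x) * z * ((B * F' - A * F) * (- x / ((1 - v) * D))))
       = (1 + z * A) * F - (1 - \<nu> * x) / (1 - x) * z * A * F'"
proof -
  define a where "a = 1 - x"
  have a: "a \<noteq> 0" using assms by (simp add: a_def)
  have v: "1 - v \<noteq> 0" using assms by simp
  have w1: "1 - a * w = x / D" and w2: "1 - w = x * v / D"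
    using D by (simp_all add: w_def a_def divide_simps) (simp_all add: algebra_simps)
  have cF: "(D - \<nu> * x) / a * (p * (\<nu> * (1 - a * w) + a * w) * (x / ((1 - v) * D)))
      - x * \<nu> * (1 - \<nu>) / a * (A * (x / ((1 - v) * D))) = A"
  proof -
    have "(D - \<nu> * x) * (\<nu> * x + a * (1 - v)) - x\<^sup>2 * \<nu> * (1 - \<nu>) = a * (1 - v) * D"
      unfolding D(2) a_def by (simp add: algebra_simps power2_eq_square)
    moreover have "(D - \<nu> * x) / a * (p * (\<nu> * (1 - a * w) + a * w) * (x / ((1 - v) * D)))
      - x * \<nu> * (1 - \<nu>) / a * (A * (x / ((1 - v) * D)))
      = p * x / (a * (1 - v) * D\<^sup>2) * ((D - \<nu> * x) * (\<nu> * x + a * (1 - v)) - x\<^sup>2 * \<nu> * (1 - \<nu>))"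
      unfolding w1 unfolding w_def A_def using a v D(1)
      by (simp add: divide_simps power2_eq_square) (simp add: algebra_simps)
    ultimately show ?thesis
      unfolding A_def using a v D(1) by (simp add: divide_simps power2_eq_square)
  qed
  have cF': "(D - \<nu> * x) / a * (p * (\<nu> * (1 - w) + w) * (x / ((1 - v) * D)))
      - x * \<nu> * (1 - \<nu>) / a * (B * (x / ((1 - v) * D))) = (1 - \<nu> * x) / a * A"
  proof -
    have "(D - \<nu> * x) * (\<nu> * x * v + (1 - v)) - x\<^sup>2 * \<nu> * (1 - \<nu>) * v = (1 - \<nu> * x) * (1 - v) * D"
      unfolding D(2) by (simp add: algebra_simps power2_eq_square)
    moreover have "(D - \<nu> * x) / a * (p * (\<nu> * (1 - w) + w) * (x / ((1 - v) * D)))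
      - x * \<nu> * (1 - \<nu>) / a * (B * (x / ((1 - v) * D)))
      = p * x / (a * (1 - v) * D\<^sup>2) * ((D - \<nu> * x) * (\<nu> * x * v + (1 - v)) - x\<^sup>2 * \<nu> * (1 - \<nu>) * v)"
      unfolding w2 unfolding w_def B_def using a v D(1)
      by (simp add: divide_simps power2_eq_square) (simp add: algebra_simps)
    ultimately show ?thesis
      unfolding A_def using a v D(1) by (simp add: divide_simps power2_eq_square)
  qed
  have "- (- F + (D - \<nu> * x) / a *
             (z * p * ((\<nu> * (1 - a * w) + a * w) * F - (\<nu> * (1 - w) + w) * F')
               * (- x / ((1 - v) * D)))
           + x * \<nu> * (1 - \<nu>) / a * z * ((B * F' - A * F) * (- x / ((1 - v) * D))))
      = F + z * F * ((D - \<nu> * x) / a * (p * (\<nu> * (1 - a * w) + a * w) * (x / ((1 - v) * D)))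
      - x * \<nu> * (1 - \<nu>) / a * (A * (x / ((1 - v) * D))))
      - z * F' * ((D - \<nu> * x) / a * (p * (\<nu> * (1 - w) + w) * (x / ((1 - v) * D)))
      - x * \<nu> * (1 - \<nu>) / a * (B * (x / ((1 - v) * D))))"
    unfolding minus_divide_left[symmetric]
    by (simp only: right_diff_distrib left_diff_distrib mult_minus_left mult_minus_right
        distrib_left distrib_right minus_add_distrib minus_minus minus_diff_eq mult_ac) simp
  also have "\<dots> = (1 + z * A) * F - (1 - \<nu> * x) / a * z * A * F'"
    unfolding cF cF' by (simp add: algebra_simps)
  finally show ?thesis
    unfolding a_def .
qed

lemma L_primitive_has_field_derivative:
  assumes f: "f \<in> H0" and x: "x \<notin> \<real>\<^sub>\<le>\<^sub>0" "x \<noteq> 1" and s: "0 \<le> s" "s < 1"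
    and G: "\<And>u. (G has_field_derivative logM' x \<nu> f z u) (at u)"
  shows "(L_primitive x \<nu> f z G has_field_derivative L_integrand x \<nu> f z s) (at (of_real s))"
proof -
  define v where "v = complex_of_real s"
  define D where "D = 1 - (1 - x) * v"
  define u where "u = logpath x v"
  have Dn: "D \<notin> \<real>\<^sub>\<le>\<^sub>0"
    using segment_to_x_avoids_slit[of x s] x s by (simp add: D_def v_def)
  have D: "D \<noteq> 0" using Dn by auto
  have v: "v \<noteq> 1" "1 - v \<notin> \<real>\<^sub>\<le>\<^sub>0"
    using s by (auto simp: v_def complex_nonpos_Reals_iff)
  have U: "(logpath x has_field_derivative - x / ((1 - v) * D)) (at v)"
    using logpath_has_field_derivative[of v x] v Dn by (simp add: D_def)
  have w: "exp u = (1 - v) / D"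
    using exp_logpath[of v x] v D by (simp add: u_def D_def)
  have AB: "logA x \<nu> u = exp (- \<nu> * u) * (x / D)" "logB \<nu> u = exp (- \<nu> * u) * (x * v / D)"
    using logAB_logpath[of v x \<nu>] v D by (simp_all add: u_def D_def)
  have R: "kerR x \<nu> s = logA x \<nu> u" "of_real s * kerR x \<nu> s = logB \<nu> u"
    using kerR_eq_logA[OF x(1) s] by (simp_all add: u_def v_def)
  define E where "E = exp (- (z * logA x \<nu> u))"
  define F where "F = f (z * logB \<nu> u) * E"
  define F' where "F' = deriv f (z * logB \<nu> u) * E"
  define dM where "dM = z * exp (- \<nu> * u) *
      ((\<nu> * (1 - (1 - x) * exp u) + (1 - x) * exp u) * F - (\<nu> * (1 - exp u) + exp u) * F')"
  have "(logM x \<nu> f z has_field_derivative dM) (at (logpath x v))"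
    using logM_has_field_derivative_log[OF f, of x \<nu> z u]
    by (simp add: dM_def F_def F'_def E_def u_def algebra_simps)
  from DERIV_chain2[OF this U]
  have 1: "((\<lambda>v. logM x \<nu> f z (logpath x v)) has_field_derivative dM * (- x / ((1 - v) * D))) (at v)" .
  have 2: "((\<lambda>v. G (logpath x v)) has_field_derivative
      (logB \<nu> u * F' - logA x \<nu> u * F) * (- x / ((1 - v) * D))) (at v)"
    using DERIV_chain2[OF G U] by (simp add: logM'_def F_def F'_def E_def u_def algebra_simps)
  have 3: "((\<lambda>v. (1 - (1 - x) * v - \<nu> * x) / (1 - x)) has_field_derivative - 1) (at v)"
    by (rule derivative_eq_intros refl)+ (use x in \<open>simp_all add: divide_simps\<close>)
  have "(L_primitive x \<nu> f z G has_field_derivative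
      - (- 1 * logM x \<nu> f z (logpath x v)
           + dM * (- x / ((1 - v) * D)) * ((1 - (1 - x) * v - \<nu> * x) / (1 - x))
         + x * \<nu> * (1 - \<nu>) / (1 - x) * z * ((logB \<nu> u * F' - logA x \<nu> u * F) * (- x / ((1 - v) * D))))) (at v)"
    unfolding L_primitive_def[abs_def]
    by (intro DERIV_minus DERIV_add DERIV_mult[OF 3 1] DERIV_cmult 2)
  also have "- (- 1 * logM x \<nu> f z (logpath x v)
           + dM * (- x / ((1 - v) * D)) * ((1 - (1 - x) * v - \<nu> * x) / (1 - x))
         + x * \<nu> * (1 - \<nu>) / (1 - x) * z * ((logB \<nu> u * F' - logA x \<nu> u * F) * (- x / ((1 - v) * D))))
      = - (- F + (D - \<nu> * x) / (1 - x) * (dM * (- x / ((1 - v) * D)))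
         + x * \<nu> * (1 - \<nu>) / (1 - x) * z * ((logB \<nu> u * F' - logA x \<nu> u * F) * (- x / ((1 - v) * D))))"
    by (simp add: logM_def F_def E_def u_def D_def mult_ac)
  also have "\<dots> = (1 + z * logA x \<nu> u) * F - (1 - \<nu> * x) / (1 - x) * z * logA x \<nu> u * F'"
    unfolding dM_def AB w
    by (rule L_primitive_identity[OF x(2) v(1) D D_def])
  also have "\<dots> = L_integrand x \<nu> f z s"
    unfolding L_integrand_def c_const_def R(2)
    by (simp add: F_def F'_def E_def R(1) algebra_simps)
  finally show ?thesis by (simp add: v_def)
qed

section \<open>The factorization\<close>

lemma L_integrand_continuous:
  assumes f: "f \<in> H0" and x: "x \<notin> \<real>\<^sub>\<le>\<^sub>0" and \<nu>: "Re \<nu> < 0"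
  shows "continuous_on {0..1} (L_integrand x \<nu> f z)"
proof -
  have "Re (1 - (1 - x) * of_real s) \<ge> 0 \<or> Im (1 - (1 - x) * of_real s) \<noteq> 0"
    if "s \<in> {0..1}" for s
    using segment_to_x_avoids_slit[OF x, of s] that
    by (auto simp: complex_nonpos_Reals_iff simp del: of_real_diff)
  moreover have "1 - (1 - x) * of_real s \<noteq> 0" if "s \<in> {0..1}" for s
    using segment_to_x_avoids_slit[OF x, of s] that by auto
  ultimately have [continuous_intros]: "continuous_on {0..1} (kerR x \<nu>)"
    unfolding kerR_def using \<nu>
    by (intro continuous_on_mult continuous_on_const continuous_on_powr_complex continuous_intros)
       auto
  show ?thesis
    unfolding L_integrand_def
    by (intro continuous_intros H0_continuous_on[OF f])
qed

text \<open>The integral up to \<open>s < 1\<close> is an increment of \<open>L_primitive\<close>. At \<open>s = 0\<close> the boundary term vanishes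
  because \<open>f 0 = 0\<close>, and as \<open>s\<close> tends to \<open>1\<close> it decays with \<open>logM\<close>. What remains is an increment of
  the primitive \<open>G\<close> along the complex path \<open>U\<close>, and moving the end point vertically to the real axis
  makes it an increment that converges to the derivative of \<open>M_op\<close>.\<close>
lemma L_op_eq_delta_M_op:
  assumes f: "f \<in> H0" and x: "x \<notin> \<real>\<^sub>\<le>\<^sub>0" "x \<noteq> 1" and \<nu>: "Re \<nu> < 0"
  shows "L_op x \<nu> f z = x * \<nu> * (1 - \<nu>) / (1 - x) * (z * deriv (M_op x \<nu> f) z)"
proof -
  define k where "k = x * \<nu> * (1 - \<nu>) / (1 - x)"
  obtain G where G: "\<And>u. (G has_field_derivative logM' x \<nu> f z u) (at u)"
    using logM'_primitive[OF f] by metis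
  define s where "s n = 1 - inverse (real (Suc n))" for n
  define U where "U n = logpath x (of_real (s n))" for n
  define \<Phi> where "\<Phi> n = (1 - (1 - x) * of_real (s n) - \<nu> * x) / (1 - x) * logM x \<nu> f z (U n)" for n
  define \<epsilon> where "\<epsilon> n = min 1 (exp (Re (U n)))" for n
  have s: "0 \<le> s n" "s n < 1" for n
    by (simp_all add: s_def inverse_le_1_iff)
  have s1: "s \<longlonglongrightarrow> 1"
    unfolding s_def[abs_def] using tendsto_diff[OF tendsto_const LIMSEQ_inverse_real_of_nat, of 1] by simp
  have D: "1 - (1 - x) * of_real (s n) \<noteq> 0" for n
    using segment_to_x_avoids_slit[OF x(1) s(1) less_imp_le[OF s(2)], of n] by auto
  have ReU: "Re (U n) = - (Re (Ln (1 - (1 - x) * of_real (s n))) + ln (real (Suc n)))" for n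
  proof -
    have "1 - complex_of_real (s n) = of_real (inverse (real (Suc n)))"
      by (simp add: s_def)
    then have "Ln (1 - complex_of_real (s n)) = of_real (ln (inverse (real (Suc n))))"
      using Ln_of_real[of "inverse (real (Suc n))"] by simp
    then show ?thesis
      by (simp add: U_def logpath_def ln_inverse)
  qed
  have ImU: "\<bar>Im (U n)\<bar> \<le> 2 * pi" for n
  proof -
    have "1 - complex_of_real (s n) \<noteq> 0"
      using s(2)[of n] by auto
    then show ?thesis
      using mpi_less_Im_Ln[of "1 - of_real (s n)"] Im_Ln_le_pi[of "1 - of_real (s n)"]
        mpi_less_Im_Ln[OF D[of n]] Im_Ln_le_pi[OF D[of n]]
      unfolding U_def logpath_def minus_complex.sel by linarith
  qed
  have "(\<lambda>n. Re (Ln (1 - (1 - x) * of_real (s n)))) \<longlonglongrightarrow> Re (Ln (1 - (1 - x) * of_real 1))"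
    by (intro tendsto_intros s1) (use x in simp)
  moreover have "filterlim (\<lambda>n. ln (real (Suc n))) at_top sequentially"
    by (intro filterlim_compose[OF ln_at_top] filterlim_compose[OF filterlim_real_sequentially filterlim_Suc])
  ultimately have U_bot: "filterlim (\<lambda>n. Re (U n)) at_bot sequentially"
    unfolding ReU filterlim_uminus_at_bot minus_minus by (rule filterlim_tendsto_add_at_top)
  have eU: "(\<lambda>n. exp (a * Re (U n))) \<longlonglongrightarrow> 0" if "a > 0" for a
    using that by (intro filterlim_compose[OF exp_at_bot]
        filterlim_tendsto_pos_mult_at_bot[OF tendsto_const _ U_bot])
  have ev: "\<forall>\<^sub>F n in sequentially. Re (U n) \<le> 0"
    using U_bot by (auto simp: filterlim_at_bot)

  have \<Phi>: "\<Phi> \<longlonglongrightarrow> 0"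
  proof -
    obtain C where C: "\<And>u. \<lbrakk>Re u \<le> 0; \<bar>Im u\<bar> \<le> 2 * pi\<rbrakk> \<Longrightarrow>
         norm (logM x \<nu> f z u) \<le> C * exp (- Re \<nu> * Re u)"
      using logM_bounds[OF f \<nu> norm_ge_zero[of z], of "2 * pi"] by (metis order_refl)
    have "(\<lambda>n. C * exp (- Re \<nu> * Re (U n))) \<longlonglongrightarrow> C * 0"
      using \<nu> by (intro tendsto_mult tendsto_const eU) simp
    then have "(\<lambda>n. C * exp (- Re \<nu> * Re (U n))) \<longlonglongrightarrow> 0" by simp
    moreover have "\<forall>\<^sub>F n in sequentially. norm (logM x \<nu> f z (U n)) \<le> C * exp (- Re \<nu> * Re (U n))"
      using ev by eventually_elim (rule C[OF _ ImU])
    ultimately have "(\<lambda>n. logM x \<nu> f z (U n)) \<longlonglongrightarrow> 0"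
      by (rule Lim_null_comparison[rotated])
    then have "\<Phi> \<longlonglongrightarrow> (1 - (1 - x) * of_real 1 - \<nu> * x) / (1 - x) * 0"
      unfolding \<Phi>_def[abs_def] by (intro tendsto_intros s1) (use x in simp_all)
    then show ?thesis by simp
  qed

  \<comment> \<open>The minimum only makes \<open>\<epsilon> n \<le> 1\<close> hold for every \<open>n\<close>; eventually it is inactive.\<close>
  have "\<epsilon> \<longlonglongrightarrow> min 1 0"
    unfolding \<epsilon>_def[abs_def] using eU[of 1] by (intro tendsto_min tendsto_const) simp
  then have "(\<lambda>n. G 0 - G (of_real (ln (\<epsilon> n)))) \<longlonglongrightarrow> deriv (M_op x \<nu> f) z"
    by (intro M_op_holomorphic_and_deriv_limit(2)[OF f \<nu> _ _ _ G]) (simp_all add: \<epsilon>_def[abs_def])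
  moreover have "\<forall>\<^sub>F n in sequentially. G 0 - G (of_real (ln (\<epsilon> n))) = G 0 - G (of_real (Re (U n)))"
    using ev by eventually_elim (simp add: \<epsilon>_def min_def)
  ultimately have "(\<lambda>n. G 0 - G (of_real (Re (U n)))) \<longlonglongrightarrow> deriv (M_op x \<nu> f) z"
    by (rule Lim_transform_eventually)
  from tendsto_diff[OF this primitive_vertical_shift[OF f \<nu> G U_bot ImU]]
  have "(\<lambda>n. G 0 - G (U n)) \<longlonglongrightarrow> deriv (M_op x \<nu> f) z" by simp
  then have "(\<lambda>n. k * z * (G 0 - G (U n)) - \<Phi> n) \<longlonglongrightarrow> k * z * deriv (M_op x \<nu> f) z - 0"
    by (intro tendsto_intros \<Phi>)
  moreover have "integral {0..s n} (L_integrand x \<nu> f z) = k * z * (G 0 - G (U n)) - \<Phi> n" for n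
  proof -
    have "(L_integrand x \<nu> f z has_integral
        L_primitive x \<nu> f z G (of_real (s n)) - L_primitive x \<nu> f z G (of_real 0)) {0..s n}"
    proof (rule fundamental_theorem_of_calculus[OF s(1)])
      fix t assume "t \<in> {0..s n}"
      then have "0 \<le> t" "t < 1" using s(2)[of n] by auto
      from L_primitive_has_field_derivative[OF f x this G]
      show "((\<lambda>t. L_primitive x \<nu> f z G (of_real t)) has_vector_derivative L_integrand x \<nu> f z t)
          (at t within {0..s n})"
        by (rule has_vector_derivative_real_field)
    qed
    moreover have "L_primitive x \<nu> f z G (of_real (s n)) = - (\<Phi> n + k * z * G (U n))"
      by (simp add: L_primitive_def \<Phi>_def U_def k_def)
    moreover have "logM x \<nu> f z 0 = 0" "logpath x 0 = 0"
      using f by (simp_all add: logM_def logB_def H0_def logpath_def)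
    then have "L_primitive x \<nu> f z G (of_real 0) = - (k * z * G 0)"
      by (simp add: L_primitive_def k_def)
    ultimately show ?thesis
      by (simp add: integral_unique right_diff_distrib)
  qed
  ultimately have "(\<lambda>n. integral {0..s n} (L_integrand x \<nu> f z)) \<longlonglongrightarrow> k * z * deriv (M_op x \<nu> f) z"
    by simp
  moreover have "(\<lambda>n. integral {0..s n} (L_integrand x \<nu> f z)) \<longlonglongrightarrow> L_op x \<nu> f z"
  proof -
    have "continuous_on {0..1} (\<lambda>t. integral {0..t} (L_integrand x \<nu> f z))"
      by (intro indefinite_integral_continuous_1 integrable_continuous_real L_integrand_continuous f x \<nu>)
    from continuous_on_tendsto_compose[OF this s1] show ?thesis
      using s(1) less_imp_le[OF s(2)] by (simp add: L_op_def)
  qed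
  ultimately show ?thesis
    using LIMSEQ_unique by (fastforce simp: k_def mult.assoc)
qed

theorem proposition3p2:
  fixes x \<nu> :: complex
  assumes "x \<notin> \<real>\<^sub>\<le>\<^sub>0" and "x \<noteq> 1" and "Re \<nu> < 0"
  shows "(\<forall>f\<in>H0. \<forall>z.
            L_integrand x \<nu> f z absolutely_integrable_on {0..1} \<and>
            M_integrand x \<nu> f z absolutely_integrable_on {0<..1}) \<and>
         L_op x \<nu> \<in> H0 \<rightarrow> H0 \<and>
         M_op x \<nu> \<in> H0 \<rightarrow> H0 \<and>
         (\<forall>f\<in>H0. \<forall>z.
            L_op x \<nu> f z =
              (x * \<nu> * (1 - \<nu>) / (1 - x)) * (delta_op \<circ> M_op x \<nu>) f z)"
proof -
  have eq: "L_op x \<nu> f z = (x * \<nu> * (1 - \<nu>) / (1 - x)) * (delta_op \<circ> M_op x \<nu>) f z"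
    if "f \<in> H0" for f z
    using L_op_eq_delta_M_op[OF that assms] by (simp add: delta_op_def)
  have M_hol: "M_op x \<nu> f holomorphic_on UNIV" if "f \<in> H0" for f
    by (rule M_op_holomorphic_and_deriv_limit(1)[OF that assms(3) _ _ LIMSEQ_inverse_real_of_nat])
       (auto simp: inverse_le_1_iff)
  have M: "M_op x \<nu> f \<in> H0" if "f \<in> H0" for f
    using M_hol[OF that] that by (simp add: H0_def M_op_def M_integrand_def[abs_def])
  have L: "L_op x \<nu> f \<in> H0" if "f \<in> H0" for f
  proof -
    have "L_op x \<nu> f = (\<lambda>z. x * \<nu> * (1 - \<nu>) / (1 - x) * (z * deriv (M_op x \<nu> f) z))"
      using L_op_eq_delta_M_op[OF that assms] by blast
    moreover have "deriv (M_op x \<nu> f) holomorphic_on UNIV"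
      using M_hol[OF that] by (intro holomorphic_deriv) auto
    ultimately show ?thesis
      using assms(2) by (auto simp: H0_def intro!: holomorphic_intros)
  qed
  show ?thesis
    by (intro conjI ballI allI funcsetI eq M L M_absolutely_integrable assms
        absolutely_integrable_continuous_real L_integrand_continuous)
qed

end
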